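(* (Reduction of order II.) Let $t_0\in\mathcal I$, and assume $x$ is a solution of $Lx=0$ with $x\neq 0$ on $\mathcal I$. Then $y$ is a second linearly independent solution of $Lx=0$ if and only if $y$ satisfies the first-order equation $$D^{\alpha}[y/x](t)-\kappa_1(t)[y/x](t)=\frac{c\,e_0^2(t,t_0)}{p(t)x^2(t)},\qquad t\in\mathcal I,\quad t\ge t_0,$$ for some constant $c\in\mathbb R$, if and only if $y$ is of the form $$y(t)=c_1x(t)+c_2x(t)\int_{t_0}^{t}\frac{e_0^2(s,t_0)}{p(s)x^2(s)}\,d_\alpha s$$ for $t\in\mathcal I$ with $t\ge t_0$, where $c_1,c_2\in\mathbb R$ are constants. In the latter case, $$c_1=y(t_0)/x(t_0),\qquad c_2=p(t_0)W(x,y)(t_0).$$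
   Context: $\mathcal I\subseteq\mathbb R$ is an interval. The functions $\kappa_0,\kappa_1:[0,1]\times\mathcal I\to[0,\infty)$ are continuous and satisfy, for all $t\in\mathcal I$: $\lim_{\alpha\to0^+}\kappa_1(\alpha,t)=1$, $\lim_{\alpha\to0^+}\kappa_0(\alpha,t)=0$, $\lim_{\alpha\to1^-}\kappa_1(\alpha,t)=0$, $\lim_{\alpha\to1^-}\kappa_0(\alpha,t)=1$, $\kappa_1(\alpha,t)\ne0$ for $\alpha\in[0,1)$, and $\kappa_0(\alpha,t)\neq0$ for $\alpha\in(0,1]$. Fix $\alpha\in(0,1]$ and write $\kappa_j(t)=\kappa_j(\alpha,t)$. The conformable (proportional) derivative is $D^{\alpha}f(t)=\kappa_1(t)f(t)+\kappa_0(t)f'(t)$. Write $d_\alpha s=ds/\kappa_0(s)$ and $e_0(t,s)=\exp\left(-\int_s^t\frac{\kappa_1(\tau)}{\kappa_0(\tau)}\,d\tau\right)$, with $e_0^2(t,s)=(e_0(t,s))^2$. Let $p,q$ be continuous on $\mathcal I$ with $p(t)>0$ for all $t\in\mathcal I$, and set $Lx=D^{\alpha}[pD^{\alpha}x]+qx$. A solution of $Lx=0$ on $\mathcal I$ is a continuous function $x$ on $\mathcal I$ such that $D^{\alpha}x$ and $D^{\alpha}[pD^{\alpha}x]$ are continuous on $\mathcal I$ and $Lx(t)=0$ for all $t\in\mathcal I$. The conformable Wronskian is $W(x,y)=xD^{\alpha}y-yD^{\alpha}x$.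
   Formalization: For linear independence the constants c and c_2 are required to be nonzero; with arbitrary constants the equivalences hold without independence. Solution, equation and formula are taken on one common set, I or {t in I : t >= t_0}, having more than one point. *)

theory Defs
  imports "HOL-Analysis.Analysis"
begin

definition conformable_kernels ::
    "real set \<Rightarrow> (real \<Rightarrow> real \<Rightarrow> real) \<Rightarrow> (real \<Rightarrow> real \<Rightarrow> real) \<Rightarrow> bool" where
  "conformable_kernels I \<kappa>0 \<kappa>1 \<longleftrightarrow>
     continuous_on ({0..1} \<times> I) (\<lambda>(\<alpha>, t). \<kappa>0 \<alpha> t) \<and>
     continuous_on ({0..1} \<times> I) (\<lambda>(\<alpha>, t). \<kappa>1 \<alpha> t) \<and>
     (\<forall>\<alpha>\<in>{0..1}. \<forall>t\<in>I. \<kappa>0 \<alpha> t \<ge> 0 \<and> \<kappa>1 \<alpha> t \<ge> 0) \<and>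
     (\<forall>t\<in>I. ((\<lambda>\<alpha>. \<kappa>1 \<alpha> t) \<longlongrightarrow> 1) (at_right 0) \<and>
            ((\<lambda>\<alpha>. \<kappa>0 \<alpha> t) \<longlongrightarrow> 0) (at_right 0) \<and>
            ((\<lambda>\<alpha>. \<kappa>1 \<alpha> t) \<longlongrightarrow> 0) (at_left 1) \<and>
            ((\<lambda>\<alpha>. \<kappa>0 \<alpha> t) \<longlongrightarrow> 1) (at_left 1) \<and>
            (\<forall>\<alpha>\<in>{0..<1}. \<kappa>1 \<alpha> t \<noteq> 0) \<and>
            (\<forall>\<alpha>\<in>{0<..1}. \<kappa>0 \<alpha> t \<noteq> 0))"

text \<open>In the following, \<open>k0\<close> and \<open>k1\<close> are the functions \<open>\<kappa>\<^sub>0(\<alpha>, \<cdot>)\<close> and \<open>\<kappa>\<^sub>1(\<alpha>, \<cdot>)\<close> for a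
  fixed \<open>\<alpha>\<close>, and \<open>J\<close> is the interval on which functions are considered. Derivatives are taken
  within \<open>J\<close>, so they are one-sided at an endpoint belonging to \<open>J\<close>. As \<open>vector_derivative\<close>
  is total, differentiability has to be required separately wherever it is meant.\<close>

definition conf_deriv ::
    "(real \<Rightarrow> real) \<Rightarrow> (real \<Rightarrow> real) \<Rightarrow> real set \<Rightarrow> (real \<Rightarrow> real) \<Rightarrow> real \<Rightarrow> real" where
  "conf_deriv k0 k1 J f t = k1 t * f t + k0 t * vector_derivative f (at t within J)"

definition conf_exp0 :: "(real \<Rightarrow> real) \<Rightarrow> (real \<Rightarrow> real) \<Rightarrow> real \<Rightarrow> real \<Rightarrow> real" where
  "conf_exp0 k0 k1 t s = exp (- (LBINT \<tau>=s..t. k1 \<tau> / k0 \<tau>))"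

text \<open>The integral with respect to \<open>d\<^sub>\<alpha>s = ds / \<kappa>\<^sub>0(s)\<close>. Here and in \<open>conf_exp0\<close> the
  interval integral is oriented, i.e. it changes sign when the limits are swapped.\<close>

definition conf_integral :: "(real \<Rightarrow> real) \<Rightarrow> real \<Rightarrow> real \<Rightarrow> (real \<Rightarrow> real) \<Rightarrow> real" where
  "conf_integral k0 a b f = (LBINT s=a..b. f s / k0 s)"

definition conf_L ::
    "(real \<Rightarrow> real) \<Rightarrow> (real \<Rightarrow> real) \<Rightarrow> (real \<Rightarrow> real) \<Rightarrow> (real \<Rightarrow> real) \<Rightarrow>
     real set \<Rightarrow> (real \<Rightarrow> real) \<Rightarrow> real \<Rightarrow> real" where
  "conf_L k0 k1 p q J x t =
     conf_deriv k0 k1 J (\<lambda>s. p s * conf_deriv k0 k1 J x s) t + q t * x t"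

definition conf_solution ::
    "(real \<Rightarrow> real) \<Rightarrow> (real \<Rightarrow> real) \<Rightarrow> (real \<Rightarrow> real) \<Rightarrow> (real \<Rightarrow> real) \<Rightarrow>
     real set \<Rightarrow> (real \<Rightarrow> real) \<Rightarrow> bool" where
  "conf_solution k0 k1 p q J x \<longleftrightarrow>
     continuous_on J x \<and>
     x differentiable_on J \<and>
     continuous_on J (conf_deriv k0 k1 J x) \<and>
     (\<lambda>s. p s * conf_deriv k0 k1 J x s) differentiable_on J \<and>
     continuous_on J (conf_deriv k0 k1 J (\<lambda>s. p s * conf_deriv k0 k1 J x s)) \<and>
     (\<forall>t\<in>J. conf_L k0 k1 p q J x t = 0)"

definition conf_wronskian ::
    "(real \<Rightarrow> real) \<Rightarrow> (real \<Rightarrow> real) \<Rightarrow> real set \<Rightarrow>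
     (real \<Rightarrow> real) \<Rightarrow> (real \<Rightarrow> real) \<Rightarrow> real \<Rightarrow> real" where
  "conf_wronskian k0 k1 J x y t =
     x t * conf_deriv k0 k1 J y t - y t * conf_deriv k0 k1 J x t"

definition lin_indep_on :: "real set \<Rightarrow> (real \<Rightarrow> real) \<Rightarrow> (real \<Rightarrow> real) \<Rightarrow> bool" where
  "lin_indep_on J x y \<longleftrightarrow>
     (\<forall>a b. (\<forall>t\<in>J. a * x t + b * y t = 0) \<longrightarrow> a = 0 \<and> b = 0)"

text \<open>The first-order equation
  \<open>D\<^sup>\<alpha>[y/x] - \<kappa>\<^sub>1[y/x] = c e\<^sub>0\<^sup>2(t, t\<^sub>0) / (p x\<^sup>2)\<close> on \<open>J\<close>, with \<open>y/x\<close> differentiable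
  so that its left-hand side is meaningful.\<close>

definition first_order_eq ::
    "(real \<Rightarrow> real) \<Rightarrow> (real \<Rightarrow> real) \<Rightarrow> (real \<Rightarrow> real) \<Rightarrow> real \<Rightarrow> real set \<Rightarrow>
     (real \<Rightarrow> real) \<Rightarrow> (real \<Rightarrow> real) \<Rightarrow> real \<Rightarrow> bool" where
  "first_order_eq k0 k1 p t0 J x y c \<longleftrightarrow>
     (\<lambda>s. y s / x s) differentiable_on J \<and>
     (\<forall>t\<in>J. conf_deriv k0 k1 J (\<lambda>s. y s / x s) t - k1 t * (y t / x t)
              = c * (conf_exp0 k0 k1 t t0)\<^sup>2 / (p t * (x t)\<^sup>2))"

definition reduction_form ::
    "(real \<Rightarrow> real) \<Rightarrow> (real \<Rightarrow> real) \<Rightarrow> (real \<Rightarrow> real) \<Rightarrow> real \<Rightarrow> real set \<Rightarrow>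
     (real \<Rightarrow> real) \<Rightarrow> (real \<Rightarrow> real) \<Rightarrow> real \<Rightarrow> real \<Rightarrow> bool" where
  "reduction_form k0 k1 p t0 J x y c1 c2 \<longleftrightarrow>
     (\<forall>t\<in>J. y t = c1 * x t
              + c2 * x t * conf_integral k0 t0 t
                  (\<lambda>s. (conf_exp0 k0 k1 s t0)\<^sup>2 / (p s * (x s)\<^sup>2)))"

end

theory Submission
  imports Defs
begin

text \<open>Write \<open>u = y / x\<close>. Since \<open>D\<^sup>\<alpha> u - \<kappa>\<^sub>1 u = \<kappa>\<^sub>0 u'\<close>, the first-order equation prescribes \<open>u'\<close>
  and the fundamental theorem of calculus turns it into the integral representation. On the other
  hand \<open>w = p W(x, y) = p \<kappa>\<^sub>0 x\<^sup>2 u'\<close>, and for two solutions Abel's identity \<open>w' = - 2 (\<kappa>\<^sub>1 / \<kappa>\<^sub>0) w\<close>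
  gives \<open>w = w(t\<^sub>0) e\<^sub>0\<^sup>2(\<cdot>, t\<^sub>0)\<close>, which is the first-order equation with \<open>c = w(t\<^sub>0)\<close>. The second
  solution is independent of \<open>x\<close> exactly if \<open>u\<close> is not constant, that is, if \<open>c \<noteq> 0\<close>.\<close>

section \<open>Calculus within an arbitrary interval\<close>

text \<open>\<open>J\<close> may be open or unbounded, whereas \<open>interval_integral_FTC2\<close>
  works on a compact interval. A derivative at \<open>t\<close> only sees \<open>J\<close> near
  \<open>t\<close>, so \<open>J\<close> can be replaced by some \<open>{a..b}\<close> that also
  contains the base point \<open>s\<close> of the integral.\<close>

lemma at_within_interval_eq_Icc:
  fixes J :: "real set"
  assumes "is_interval J" "s \<in> J" "t \<in> J"
  obtains a b where "{a..b} \<subseteq> J" "a \<le> s" "s \<le> b" "a \<le> t" "t \<le> b"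
    "at t within J = at t within {a..b}"
proof -
  \<comment> \<open>If \<open>t\<close> is the least point of \<open>J\<close>, then
    \<open>a = t\<close> serves; otherwise \<open>a\<close> is the smaller of \<open>s\<close> and a
    point of \<open>J\<close> left of \<open>t\<close>. The last disjunct records the case;
    \<open>b\<close> is chosen symmetrically.\<close>
  obtain a where a: "a \<in> J" "a \<le> s" "a \<le> t" "a < t \<or> (\<forall>r\<in>J. t \<le> r)"
  proof (cases "\<forall>r\<in>J. t \<le> r")
    case True
    then show ?thesis using that[of t] assms by auto
  next
    case False
    then obtain r where "r \<in> J" "r < t" by auto
    then show ?thesis using that[of "min r s"] assms by (auto simp: min_def)
  qed
  obtain b where b: "b \<in> J" "s \<le> b" "t \<le> b" "t < b \<or> (\<forall>r\<in>J. r \<le> t)"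
  proof (cases "\<forall>r\<in>J. r \<le> t")
    case True
    then show ?thesis using that[of t] assms by auto
  next
    case False
    then obtain r where "r \<in> J" "t < r" by auto
    then show ?thesis using that[of "max r s"] assms by (auto simp: max_def)
  qed
  have sub: "{a..b} \<subseteq> J"
    using interval_subset_is_interval[OF assms(1), of a b] a(1) b(1) by simp
  \<comment> \<open>\<open>U\<close> cuts only on the sides where \<open>{a..b}\<close> extends
    beyond \<open>t\<close>. On any other side \<open>t\<close> is an endpoint of \<open>J\<close>
    itself, so there is nothing to cut off.\<close>
  define U where "U = (if a < t then {a<..} else UNIV) \<inter> (if t < b then {..<b} else UNIV)"
  have "open U" "t \<in> U"
    unfolding U_def by auto
  moreover have "J \<inter> U - {t} = {a..b} \<inter> U - {t}"
    using sub a(3,4) b(3,4) unfolding U_def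
    by (cases "a < t"; cases "t < b") (auto simp: less_imp_le dest: order_antisym)
  ultimately have "at t within J = at t within {a..b}"
    by (intro at_within_nhd[of t U])
  with a b sub show ?thesis using that by blast
qed

lemma interval_integral_has_real_derivative_within:
  fixes f :: "real \<Rightarrow> real"
  assumes J: "is_interval J" "s \<in> J" "t \<in> J" and f: "continuous_on J f"
  shows "((\<lambda>r. LBINT \<tau>=s..r. f \<tau>) has_real_derivative f t) (at t within J)"
proof -
  obtain a b where ab: "{a..b} \<subseteq> J" "a \<le> s" "s \<le> b" "a \<le> t" "t \<le> b"
    "at t within J = at t within {a..b}"
    using at_within_interval_eq_Icc[OF J] by blast
  have "continuous_on {a..b} f"
    using f ab(1) continuous_on_subset by blast
  then have "((\<lambda>r. LBINT \<tau>=s..r. f \<tau>) has_vector_derivative f t) (at t within {a..b})"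
    using ab by (intro interval_integral_FTC2) auto
  then show ?thesis
    using ab(6) by (simp add: has_real_derivative_iff_has_vector_derivative)
qed

lemma has_real_derivative_transform:
  fixes f g :: "real \<Rightarrow> real"
  assumes "t \<in> J" "(f has_real_derivative f') (at t within J)" "\<And>s. s \<in> J \<Longrightarrow> g s = f s"
  shows "(g has_real_derivative f') (at t within J)"
  using has_derivative_transform[OF assms(1,3)] assms(2) unfolding has_field_derivative_def by simp

section \<open>The conformable derivative and exponential on a nondegenerate interval\<close>

locale conformable_interval =
  fixes J :: "real set" and k0 k1 :: "real \<Rightarrow> real" and t0 :: real
  assumes interval: "is_interval J"
    and t0: "t0 \<in> J"
    and nondegenerate: "\<exists>t\<in>J. t \<noteq> t0"
    and k0_cont: "continuous_on J k0"
    and k1_cont: "continuous_on J k1"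
    and k0_pos: "\<And>t. t \<in> J \<Longrightarrow> k0 t > 0"
begin

abbreviation D where "D \<equiv> conf_deriv k0 k1 J"
abbreviation e0 where "e0 t \<equiv> conf_exp0 k0 k1 t t0"

text \<open>A connected set with at least two points has no isolated point. This makes derivatives
  within \<open>J\<close> unique, so that \<open>D_eq\<close> can evaluate the total
  \<open>vector_derivative\<close>.\<close>

lemma at_within_nontrivial:
  assumes "t \<in> J"
  shows "at t within J \<noteq> bot"
proof -
  obtain s where "s \<in> J" "s \<noteq> t"
    using nondegenerate t0 by metis
  moreover have "connected J"
    using interval is_interval_connected by blast
  ultimately have "t islimpt J"
    using assms by (intro connected_imp_perfect) auto
  then show ?thesis
    using trivial_limit_within by blast
qed

lemma D_eq:
  assumes "t \<in> J" "(f has_real_derivative f') (at t within J)"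
  shows "D f t = k1 t * f t + k0 t * f'"
  unfolding conf_deriv_def
  using assms at_within_nontrivial[OF assms(1)]
  by (simp add: has_real_derivative_iff_has_vector_derivative vector_derivative_within)

text \<open>Solving the definition of \<open>D\<close> for the ordinary derivative; the usual
  product and quotient rules then apply to equations given in terms of \<open>D\<close>.\<close>

lemma differentiable_on_has_derivative:
  fixes f :: "real \<Rightarrow> real"
  assumes "f differentiable_on J" "t \<in> J"
  shows "(f has_real_derivative (D f t - k1 t * f t) / k0 t) (at t within J)"
proof -
  obtain f' where f': "(f has_real_derivative f') (at t within J)"
    using assms unfolding differentiable_on_def real_differentiable_def by blast
  with D_eq[OF assms(2) f'] k0_pos[OF assms(2)] show ?thesis by simp
qed

lemma differentiable_onI:
  fixes f :: "real \<Rightarrow> real"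
  assumes "\<And>t. t \<in> J \<Longrightarrow> (f has_real_derivative f' t) (at t within J)"
  shows "f differentiable_on J"
  using assms unfolding differentiable_on_def real_differentiable_def by blast

lemma constant_if_zero_derivative:
  fixes f :: "real \<Rightarrow> real"
  assumes "\<And>t. t \<in> J \<Longrightarrow> (f has_real_derivative 0) (at t within J)" "t \<in> J"
  shows "f t = f t0"
proof -
  obtain a where "\<And>s. s \<in> J \<Longrightarrow> f s = a"
    using has_field_derivative_zero_constant[OF is_interval_convex[OF interval] assms(1)] by blast
  with t0 assms(2) show ?thesis by simp
qed

lemma e0_pos: "e0 t > 0"
  by (simp add: conf_exp0_def)

lemma e0_t0: "e0 t0 = 1"
  by (simp add: conf_exp0_def)

text \<open>The chain rule and the fundamental theorem of calculus. Equivalently,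
  \<open>D e0\<close> vanishes on \<open>J\<close>.\<close>

lemma e0_has_derivative:
  assumes "t \<in> J"
  shows "(e0 has_real_derivative - (k1 t / k0 t) * e0 t) (at t within J)"
proof -
  have "continuous_on J (\<lambda>\<tau>. k1 \<tau> / k0 \<tau>)"
    using k0_pos by (intro continuous_intros k0_cont k1_cont) force
  from interval_integral_has_real_derivative_within[OF interval t0 assms this]
  show ?thesis
    unfolding conf_exp0_def by (auto intro!: derivative_eq_intros)
qed

lemma e0_cont: "continuous_on J e0"
  by (rule DERIV_continuous_on[OF e0_has_derivative])

end

section \<open>The first-order equation for \<open>y / x\<close> and its integral form\<close>

locale conformable_solution = conformable_interval +
  fixes p q x :: "real \<Rightarrow> real"
  assumes p_cont: "continuous_on J p" and q_cont: "continuous_on J q"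
    and p_pos: "\<And>t. t \<in> J \<Longrightarrow> p t > 0"
    and x_solution: "conf_solution k0 k1 p q J x"
    and x_nonzero: "\<And>t. t \<in> J \<Longrightarrow> x t \<noteq> 0"
begin

text \<open>The right-hand side of the first-order equation for \<open>c = 1\<close>. The weight of
  \<open>d_\<alpha> s\<close> is left out, so it is \<open>g t / k0 t\<close> that appears as an
  ordinary derivative.\<close>

abbreviation g where "g s \<equiv> (e0 s)\<^sup>2 / (p s * (x s)\<^sup>2)"

lemma x_cont: "continuous_on J x"
  using x_solution by (simp add: conf_solution_def)

text \<open>The second-order equation as a first-order system for the pair \<open>y\<close>,
  \<open>p * D y\<close>.\<close>

lemma solution_derivs:
  assumes "conf_solution k0 k1 p q J y" "t \<in> J"
  shows "(y has_real_derivative (D y t - k1 t * y t) / k0 t) (at t within J)"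
    and "((\<lambda>s. p s * D y s) has_real_derivative (- q t * y t - k1 t * (p t * D y t)) / k0 t)
           (at t within J)"
proof -
  show "(y has_real_derivative (D y t - k1 t * y t) / k0 t) (at t within J)"
    using assms differentiable_on_has_derivative by (simp add: conf_solution_def)
  have "D (\<lambda>s. p s * D y s) t = - q t * y t"
    using assms unfolding conf_solution_def conf_L_def by fastforce
  then show "((\<lambda>s. p s * D y s) has_real_derivative
      (- q t * y t - k1 t * (p t * D y t)) / k0 t) (at t within J)"
    using assms differentiable_on_has_derivative[of "\<lambda>s. p s * D y s" t]
    by (simp add: conf_solution_def)
qed

lemma first_order_eq_iff:
  "first_order_eq k0 k1 p t0 J x y c \<longleftrightarrow>
     (\<forall>t\<in>J. ((\<lambda>s. y s / x s) has_real_derivative c * (g t / k0 t)) (at t within J))"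
proof
  assume fo: "first_order_eq k0 k1 p t0 J x y c"
  show "\<forall>t\<in>J. ((\<lambda>s. y s / x s) has_real_derivative c * (g t / k0 t)) (at t within J)"
  proof
    fix t assume t: "t \<in> J"
    have "D (\<lambda>s. y s / x s) t - k1 t * (y t / x t) = c * g t"
      using fo t by (simp add: first_order_eq_def)
    then show "((\<lambda>s. y s / x s) has_real_derivative c * (g t / k0 t)) (at t within J)"
      using fo t differentiable_on_has_derivative[of "\<lambda>s. y s / x s" t]
      by (simp add: first_order_eq_def)
  qed
next
  assume u: "\<forall>t\<in>J. ((\<lambda>s. y s / x s) has_real_derivative c * (g t / k0 t)) (at t within J)"
  have "D (\<lambda>s. y s / x s) t - k1 t * (y t / x t) = c * g t" if "t \<in> J" for t
    using D_eq[OF that] u that k0_pos[OF that] by fastforce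
  then show "first_order_eq k0 k1 p t0 J x y c"
    using u differentiable_onI unfolding first_order_eq_def by fastforce
qed

lemma integral_has_derivative:
  assumes "t \<in> J"
  shows "((\<lambda>t. conf_integral k0 t0 t g) has_real_derivative g t / k0 t) (at t within J)"
proof -
  have "p s \<noteq> 0" "k0 s \<noteq> 0" "x s \<noteq> 0" if "s \<in> J" for s
    using p_pos k0_pos x_nonzero that by force+
  then have "continuous_on J (\<lambda>s. g s / k0 s)"
    by (intro continuous_intros e0_cont p_cont x_cont k0_cont) auto
  from interval_integral_has_real_derivative_within[OF interval t0 assms this]
  show ?thesis by (simp add: conf_integral_def)
qed

lemma integral_t0: "conf_integral k0 t0 t0 g = 0"
  by (simp add: conf_integral_def)

text \<open>Under the first-order equation, \<open>y / x\<close> and \<open>c\<close> times the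
  integral have the same derivative, so they differ by a constant on \<open>J\<close>. The integral
  vanishes at \<open>t0\<close>, which fixes that constant as \<open>y t0 / x t0\<close>.\<close>

lemma first_order_eq_iff_reduction_form:
  "first_order_eq k0 k1 p t0 J x y c \<longleftrightarrow> reduction_form k0 k1 p t0 J x y (y t0 / x t0) c"
proof
  assume fo: "first_order_eq k0 k1 p t0 J x y c"
  have u: "((\<lambda>s. y s / x s) has_real_derivative c * (g t / k0 t)) (at t within J)"
    if "t \<in> J" for t
    using fo that unfolding first_order_eq_iff by auto
  have "y t / x t - c * conf_integral k0 t0 t g = y t0 / x t0 - c * conf_integral k0 t0 t0 g"
    if "t \<in> J" for t
  proof (rule constant_if_zero_derivative[OF _ that])
    fix t assume "t \<in> J"
    from DERIV_diff[OF u[OF this] DERIV_cmult[OF integral_has_derivative[OF this], of c]]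
    show "((\<lambda>t. y t / x t - c * conf_integral k0 t0 t g) has_real_derivative 0) (at t within J)"
      by simp
  qed
  then have "y t / x t = y t0 / x t0 + c * conf_integral k0 t0 t g" if "t \<in> J" for t
    using that integral_t0 by fastforce
  then have "y t = x t * (y t0 / x t0 + c * conf_integral k0 t0 t g)" if "t \<in> J" for t
    using that x_nonzero by (metis nonzero_mult_div_cancel_left times_divide_eq_right)
  then show "reduction_form k0 k1 p t0 J x y (y t0 / x t0) c"
    unfolding reduction_form_def by (simp add: algebra_simps)
next
  assume "reduction_form k0 k1 p t0 J x y (y t0 / x t0) c"
  then have eq: "y t / x t = y t0 / x t0 + c * conf_integral k0 t0 t g" if "t \<in> J" for t
    using that x_nonzero[OF that] unfolding reduction_form_def by (simp add: add_divide_distrib)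
  have "((\<lambda>s. y s / x s) has_real_derivative c * (g t / k0 t)) (at t within J)"
    if "t \<in> J" for t
  proof -
    have "((\<lambda>s. y t0 / x t0 + c * conf_integral k0 t0 s g) has_real_derivative c * (g t / k0 t))
        (at t within J)"
      using DERIV_add[OF DERIV_const DERIV_cmult[OF integral_has_derivative[OF that], of c]]
      by simp
    then show ?thesis
      by (rule has_real_derivative_transform[OF that]) (use eq in auto)
  qed
  then show "first_order_eq k0 k1 p t0 J x y c"
    unfolding first_order_eq_iff by auto
qed

lemma reduction_form_c1:
  assumes "reduction_form k0 k1 p t0 J x y c1 c2"
  shows "c1 = y t0 / x t0"
  using assms t0 x_nonzero[OF t0] integral_t0 unfolding reduction_form_def by simp

section \<open>Abel's identity and the passage between solutions and the first-order
  equation\<close>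

text \<open>In the derivative of \<open>?w\<close> the terms with \<open>q\<close> and the products
  of \<open>D x\<close> and \<open>D y\<close> cancel; what remains is \<open>- 2 * k1 / k0\<close>
  times \<open>?w\<close>. Since \<open>(e0 t)\<^sup>2\<close> satisfies the same linear equation,
  the quotient is constant.\<close>

lemma wronskian_abel:
  assumes y: "conf_solution k0 k1 p q J y" and t: "t \<in> J"
  shows "p t * conf_wronskian k0 k1 J x y t
       = p t0 * conf_wronskian k0 k1 J x y t0 * (e0 t)\<^sup>2"
proof -
  \<comment> \<open>The factor \<open>p\<close> is kept inside \<open>p t * D y t\<close> and
    \<open>p t * D x t\<close>, because \<open>p\<close> is only assumed continuous while these
    products are differentiable.\<close>
  let ?w = "\<lambda>t. x t * (p t * D y t) - y t * (p t * D x t)"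
  have "?w t / (e0 t)\<^sup>2 = ?w t0 / (e0 t0)\<^sup>2"
  proof (rule constant_if_zero_derivative[OF _ t])
    fix t assume t: "t \<in> J"
    have k: "k0 t \<noteq> 0" "e0 t \<noteq> 0"
      using k0_pos[OF t] e0_pos[of t] by auto
    have "(?w has_real_derivative - 2 * k1 t * ?w t / k0 t) (at t within J)"
      by (rule DERIV_cong[OF DERIV_diff[OF
            DERIV_mult'[OF solution_derivs(1)[OF x_solution t] solution_derivs(2)[OF y t]]
            DERIV_mult'[OF solution_derivs(1)[OF y t] solution_derivs(2)[OF x_solution t]]]])
        (use k in \<open>simp add: field_simps\<close>)
    from DERIV_divide[OF this DERIV_power[OF e0_has_derivative[OF t], of 2]]
    show "((\<lambda>t. ?w t / (e0 t)\<^sup>2) has_real_derivative 0) (at t within J)"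
      using k by (auto elim!: DERIV_cong simp: field_simps power2_eq_square)
  qed
  then show ?thesis
    using e0_pos[of t] unfolding conf_wronskian_def e0_t0 by (simp add: field_simps)
qed

lemma first_order_eq_if_solution:
  assumes y: "conf_solution k0 k1 p q J y"
  shows "first_order_eq k0 k1 p t0 J x y (p t0 * conf_wronskian k0 k1 J x y t0)"
  unfolding first_order_eq_iff
proof
  fix t assume t: "t \<in> J"
  have nz: "k0 t \<noteq> 0" "p t \<noteq> 0" "x t \<noteq> 0"
    using k0_pos[OF t] p_pos[OF t] x_nonzero[OF t] by auto
  \<comment> \<open>In the quotient rule the \<open>k1\<close> terms cancel and leave the Wronskian
    over \<open>k0 t * (x t)\<^sup>2\<close>. The fraction is expanded by \<open>p t\<close> to
    match \<open>wronskian_abel\<close>.\<close>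
  have "((\<lambda>s. y s / x s) has_real_derivative
      p t * conf_wronskian k0 k1 J x y t / (p t * (x t)\<^sup>2) / k0 t) (at t within J)"
    using nz unfolding conf_wronskian_def
    by (auto intro!: derivative_eq_intros solution_derivs(1)[OF x_solution t]
        solution_derivs(1)[OF y t] simp: field_simps power2_eq_square)
  then show "((\<lambda>s. y s / x s) has_real_derivative
      p t0 * conf_wronskian k0 k1 J x y t0 * (g t / k0 t)) (at t within J)"
    unfolding wronskian_abel[OF y t] by simp
qed

text \<open>The product rule for \<open>y = u x\<close>: the term \<open>k1 y\<close> is absorbed
  into \<open>u D x\<close>, so \<open>D y\<close> gains only \<open>k0 u' x\<close>, which the
  equation makes explicit.\<close>

lemma first_order_eq_derivs:
  assumes fo: "first_order_eq k0 k1 p t0 J x y c" and t: "t \<in> J"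
  defines "u \<equiv> \<lambda>s. y s / x s"
  shows "(y has_real_derivative
           u t * ((D x t - k1 t * x t) / k0 t) + c * (g t / k0 t) * x t) (at t within J)"
    and "D y t = u t * D x t + c * (e0 t)\<^sup>2 / (p t * x t)"
proof -
  have u: "(u has_real_derivative c * (g t / k0 t)) (at t within J)"
    using fo t unfolding first_order_eq_iff u_def by auto
  have "((\<lambda>s. u s * x s) has_real_derivative
      u t * ((D x t - k1 t * x t) / k0 t) + c * (g t / k0 t) * x t) (at t within J)"
    using DERIV_mult'[OF u solution_derivs(1)[OF x_solution t]] .
  then show y: "(y has_real_derivative
      u t * ((D x t - k1 t * x t) / k0 t) + c * (g t / k0 t) * x t) (at t within J)"
    by (rule has_real_derivative_transform[OF t]) (use x_nonzero u_def in auto)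
  show "D y t = u t * D x t + c * (e0 t)\<^sup>2 / (p t * x t)"
    unfolding D_eq[OF t y] u_def using k0_pos[OF t] p_pos[OF t] x_nonzero[OF t]
    by (simp add: field_simps power2_eq_square)
qed

text \<open>Multiplying the formula for \<open>D y\<close> by \<open>p\<close> gives
  \<open>p D y = u (p D x) + c e0^2 / x\<close>. Both summands are differentiable without
  differentiating \<open>p\<close>.\<close>

lemma solution_if_first_order_eq:
  assumes fo: "first_order_eq k0 k1 p t0 J x y c"
  shows "conf_solution k0 k1 p q J y"
proof -
  define u where "u = (\<lambda>s. y s / x s)"
  have Dy: "D y t = u t * D x t + c * (e0 t)\<^sup>2 / (p t * x t)" if "t \<in> J" for t
    using first_order_eq_derivs(2)[OF fo that] by (simp add: u_def)
  have yeq: "y t = u t * x t" if "t \<in> J" for t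
    using x_nonzero[OF that] by (simp add: u_def)
  have u: "(u has_real_derivative c * (g t / k0 t)) (at t within J)" if "t \<in> J" for t
    using fo that unfolding first_order_eq_iff u_def by auto
  have y_cont: "continuous_on J y"
    by (rule DERIV_continuous_on[OF first_order_eq_derivs(1)[OF fo]])
  have u_cont: "continuous_on J u"
    by (rule DERIV_continuous_on[OF u])
  have Py: "((\<lambda>s. p s * D y s) has_real_derivative
      (- q t * y t - k1 t * (p t * D y t)) / k0 t) (at t within J)" if t: "t \<in> J" for t
  proof -
    have nz: "k0 t \<noteq> 0" "p t \<noteq> 0" "x t \<noteq> 0"
      using k0_pos[OF t] p_pos[OF t] x_nonzero[OF t] by auto
    have 1: "((\<lambda>s. u s * (p s * D x s)) has_real_derivative
      u t * ((- q t * x t - k1 t * (p t * D x t)) / k0 t) + c * (g t / k0 t) * (p t * D x t))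
      (at t within J)"
      by (rule DERIV_mult'[OF u[OF t] solution_derivs(2)[OF x_solution t]])
    have 2: "((\<lambda>s. c * (e0 s)\<^sup>2 / x s) has_real_derivative
      - c * (e0 t)\<^sup>2 * (D x t + k1 t * x t) / (k0 t * (x t)\<^sup>2)) (at t within J)"
      using nz
      by (auto intro!: derivative_eq_intros solution_derivs(1)[OF x_solution t]
          e0_has_derivative[OF t] simp: field_simps power2_eq_square)
    \<comment> \<open>The terms \<open>c e0^2 D x / (k0 x^2)\<close> from \<open>u'\<close> and from
      \<open>1 / x\<close> cancel; the remaining \<open>k1\<close> terms combine to
      \<open>- k1 p D y / k0\<close>.\<close>
    have "((\<lambda>s. u s * (p s * D x s) + c * (e0 s)\<^sup>2 / x s) has_real_derivative
      (- q t * y t - k1 t * (p t * D y t)) / k0 t) (at t within J)"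
      by (rule DERIV_cong[OF DERIV_add[OF 1 2]])
        (use nz in \<open>simp add: yeq[OF t] Dy[OF t] field_simps power2_eq_square\<close>)
    then show ?thesis
    proof (rule has_real_derivative_transform[OF t])
      fix s assume s: "s \<in> J"
      show "p s * D y s = u s * (p s * D x s) + c * (e0 s)\<^sup>2 / x s"
        unfolding Dy[OF s] using p_pos[OF s] x_nonzero[OF s] by (simp add: field_simps)
    qed
  qed
  have DPy: "D (\<lambda>s. p s * D y s) t = - q t * y t" if "t \<in> J" for t
    using D_eq[OF that Py[OF that]] k0_pos[OF that] by (simp add: field_simps)
  have "continuous_on J (\<lambda>t. u t * D x t + c * (e0 t)\<^sup>2 / (p t * x t))"
    using x_solution p_pos x_nonzero unfolding conf_solution_def
    by (intro continuous_intros u_cont e0_cont p_cont x_cont) force+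
  then have "continuous_on J (D y)"
    using Dy by (simp cong: continuous_on_cong_simp)
  moreover have "continuous_on J (D (\<lambda>s. p s * D y s))"
    using continuous_on_mult[OF continuous_on_minus[OF q_cont] y_cont] DPy
    by (simp cong: continuous_on_cong_simp)
  ultimately show ?thesis
    unfolding conf_solution_def conf_L_def
    using y_cont differentiable_onI[OF first_order_eq_derivs(1)[OF fo]] differentiable_onI[OF Py] DPy by auto
qed

section \<open>The constant of the first-order equation and linear independence\<close>

text \<open>At \<open>t0\<close> the exponential equals 1, so the formula for \<open>D y\<close> can
  be solved for \<open>c\<close>. Thus \<open>c\<close> is determined by \<open>y\<close>.\<close>

lemma first_order_eq_const_eq:
  assumes "first_order_eq k0 k1 p t0 J x y c"
  shows "c = p t0 * conf_wronskian k0 k1 J x y t0"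
proof -
  have "D y t0 = y t0 / x t0 * D x t0 + c / (p t0 * x t0)"
    using first_order_eq_derivs(2)[OF assms t0] by (simp add: e0_t0)
  then show ?thesis
    using p_pos[OF t0] x_nonzero[OF t0] unfolding conf_wronskian_def by (simp add: field_simps)
qed

text \<open>For \<open>c = 0\<close> the integral form makes \<open>y\<close> a multiple of
  \<open>x\<close>. Conversely, a relation \<open>a x + b y = 0\<close> makes \<open>b y / x\<close>
  constant, whereas its derivative at \<open>t0\<close> is \<open>b c g / k0\<close> with
  \<open>g\<close> and \<open>k0\<close> positive.\<close>

lemma lin_indep_iff:
  assumes fo: "first_order_eq k0 k1 p t0 J x y c"
  shows "lin_indep_on J x y \<longleftrightarrow> c \<noteq> 0"
proof
  assume li: "lin_indep_on J x y"
  show "c \<noteq> 0"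
  proof
    assume "c = 0"
    then have "\<forall>t\<in>J. - (y t0 / x t0) * x t + 1 * y t = 0"
      using fo first_order_eq_iff_reduction_form unfolding reduction_form_def by simp
    then show False
      using li unfolding lin_indep_on_def by (metis zero_neq_one)
  qed
next
  assume c: "c \<noteq> 0"
  show "lin_indep_on J x y"
    unfolding lin_indep_on_def
  proof (intro allI impI)
    fix a b assume ab: "\<forall>t\<in>J. a * x t + b * y t = 0"
    have 1: "((\<lambda>s. b * (y s / x s)) has_real_derivative b * (c * (g t0 / k0 t0))) (at t0 within J)"
      using fo t0 unfolding first_order_eq_iff by (intro DERIV_cmult) auto
    have 2: "((\<lambda>s. b * (y s / x s)) has_real_derivative 0) (at t0 within J)"
    proof (rule has_real_derivative_transform[OF t0 DERIV_const])
      fix s assume s: "s \<in> J"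
      show "b * (y s / x s) = - a"
        using ab x_nonzero[OF s] s by (simp add: field_simps) (metis add.inverse_unique)
    qed
    \<comment> \<open>Uniqueness of the derivative at \<open>t0\<close>: \<open>D\<close> takes a
      single value there, computed by \<open>D_eq\<close> in two ways.\<close>
    have "k0 t0 * (b * (c * (g t0 / k0 t0))) = k0 t0 * 0"
      using D_eq[OF t0 1] D_eq[OF t0 2] by linarith
    then have "b = 0"
      using c e0_t0 p_pos[OF t0] x_nonzero[OF t0] k0_pos[OF t0] by auto
    with ab t0 x_nonzero show "a = 0 \<and> b = 0" by fastforce
  qed
qed

end

section \<open>Restriction to a subinterval and assembly of the equivalences\<close>

text \<open>A derivative within \<open>I\<close> is also one within \<open>J\<close>, and there it
  is unique. As \<open>D\<close> is nested in \<open>L\<close>, this agreement is needed both for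
  \<open>x\<close> and for \<open>p * D x\<close>.\<close>

lemma (in conformable_interval) conf_solution_subset:
  assumes I: "conf_solution k0 k1 p q I x" and sub: "J \<subseteq> I"
  shows "conf_solution k0 k1 p q J x"
proof -
  have deriv: "conf_deriv k0 k1 I f t = D f t" if f: "f differentiable_on I" and t: "t \<in> J" for f t
  proof -
    have "(f has_vector_derivative vector_derivative f (at t within I)) (at t within I)"
      using f t sub unfolding differentiable_on_def by (auto simp: vector_derivative_works)
    then have "(f has_real_derivative vector_derivative f (at t within I)) (at t within J)"
      using sub has_vector_derivative_within_subset
      unfolding has_real_derivative_iff_has_vector_derivative by blast
    from D_eq[OF t this] show ?thesis unfolding conf_deriv_def[of _ _ I] by simp
  qed
  \<comment> \<open>The two functions are known to agree only on \<open>J\<close>; hence derivatives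
    are transferred from \<open>?P\<close> to \<open>?Q\<close> within \<open>J\<close>.\<close>
  let ?P = "\<lambda>s. p s * conf_deriv k0 k1 I x s" and ?Q = "\<lambda>s. p s * D x s"
  have xd: "x differentiable_on I" and Pd: "?P differentiable_on I"
    using I by (auto simp: conf_solution_def)
  have PQ: "?P s = ?Q s" if "s \<in> J" for s
    using deriv[OF xd that] by simp
  have PdJ: "?P differentiable_on J"
    using Pd sub differentiable_on_subset by blast
  have Qd: "(?Q has_real_derivative (D ?P t - k1 t * ?P t) / k0 t) (at t within J)"
    if t: "t \<in> J" for t
    by (rule has_real_derivative_transform[OF t differentiable_on_has_derivative[OF PdJ t]])
      (simp add: PQ)
  have DQ: "D ?Q t = conf_deriv k0 k1 I ?P t" if t: "t \<in> J" for t
    using D_eq[OF t Qd[OF t]] PQ[OF t] deriv[OF Pd t] k0_pos[OF t] by simp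
  have "continuous_on J (D x)"
    using continuous_on_subset[OF _ sub, of "conf_deriv k0 k1 I x"] I deriv[OF xd]
    by (simp add: conf_solution_def cong: continuous_on_cong_simp)
  moreover have "continuous_on J (D ?Q)"
    using continuous_on_subset[OF _ sub, of "conf_deriv k0 k1 I ?P"] I DQ
    by (simp add: conf_solution_def cong: continuous_on_cong_simp)
  moreover have "continuous_on J x" "x differentiable_on J"
    using I sub xd continuous_on_subset differentiable_on_subset
    unfolding conf_solution_def by blast+
  ultimately show ?thesis
    using I sub DQ differentiable_onI[OF Qd] unfolding conf_solution_def conf_L_def by auto
qed

text \<open>The value \<open>c = 0\<close> yields exactly the multiples of \<open>x\<close>, so
  independence corresponds to \<open>c \<noteq> 0\<close> and \<open>c2 \<noteq> 0\<close>; the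
  unrestricted equivalences describe all solutions. Both choices of \<open>J\<close> are intervals
  containing \<open>t0\<close>, so one argument on \<open>J\<close> covers them.\<close>

theorem theorem4p2:
  fixes I J :: "real set"
    and \<kappa>0 \<kappa>1 :: "real \<Rightarrow> real \<Rightarrow> real"
    and \<alpha> t0 :: real
    and p q x y :: "real \<Rightarrow> real"
  assumes "is_interval I"
    and "conformable_kernels I \<kappa>0 \<kappa>1"
    and "0 < \<alpha>" and "\<alpha> \<le> 1"
    and "continuous_on I p" and "continuous_on I q"
    and "\<forall>t\<in>I. p t > 0"
    and "t0 \<in> I"
    and "conf_solution (\<kappa>0 \<alpha>) (\<kappa>1 \<alpha>) p q I x"
    and "\<forall>t\<in>I. x t \<noteq> 0"
    and "J = {t \<in> I. t \<ge> t0} \<or> J = I"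
    and "\<exists>t\<in>J. t \<noteq> t0"
  shows "((conf_solution (\<kappa>0 \<alpha>) (\<kappa>1 \<alpha>) p q J y \<and> lin_indep_on J x y) \<longleftrightarrow>
            (\<exists>c. c \<noteq> 0 \<and> first_order_eq (\<kappa>0 \<alpha>) (\<kappa>1 \<alpha>) p t0 J x y c)) \<and>
         ((\<exists>c. c \<noteq> 0 \<and> first_order_eq (\<kappa>0 \<alpha>) (\<kappa>1 \<alpha>) p t0 J x y c) \<longleftrightarrow>
            (\<exists>c1 c2. c2 \<noteq> 0 \<and> reduction_form (\<kappa>0 \<alpha>) (\<kappa>1 \<alpha>) p t0 J x y c1 c2)) \<and>
         (conf_solution (\<kappa>0 \<alpha>) (\<kappa>1 \<alpha>) p q J y \<longleftrightarrow>
            (\<exists>c. first_order_eq (\<kappa>0 \<alpha>) (\<kappa>1 \<alpha>) p t0 J x y c)) \<and>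
         ((\<exists>c. first_order_eq (\<kappa>0 \<alpha>) (\<kappa>1 \<alpha>) p t0 J x y c) \<longleftrightarrow>
            (\<exists>c1 c2. reduction_form (\<kappa>0 \<alpha>) (\<kappa>1 \<alpha>) p t0 J x y c1 c2)) \<and>
         (\<forall>c1 c2. reduction_form (\<kappa>0 \<alpha>) (\<kappa>1 \<alpha>) p t0 J x y c1 c2 \<longrightarrow>
            c1 = y t0 / x t0 \<and>
            c2 = p t0 * conf_wronskian (\<kappa>0 \<alpha>) (\<kappa>1 \<alpha>) J x y t0)"
proof -
  have "{t \<in> I. t \<ge> t0} = I \<inter> {t0..}" by auto
  then have J: "J \<subseteq> I" "is_interval J" "t0 \<in> J"
    using assms(1,8,11) by (auto intro: is_interval_Int)
  have kernel_cont: "continuous_on J (k \<alpha>)"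
    if "continuous_on ({0..1} \<times> I) (\<lambda>(\<alpha>, t). k \<alpha> t)" for k :: "real \<Rightarrow> real \<Rightarrow> real"
  proof -
    have "continuous_on J (\<lambda>t. (\<lambda>(\<alpha>, t). k \<alpha> t) (\<alpha>, t))"
      using assms(3,4) J(1)
      by (intro continuous_on_compose2[OF that] continuous_intros) auto
    then show ?thesis by simp
  qed
  have k0_nonneg: "\<kappa>0 \<alpha> t \<ge> 0" and k0_nonzero: "\<kappa>0 \<alpha> t \<noteq> 0" if "t \<in> J" for t
    using assms(2,3,4) J(1) that unfolding conformable_kernels_def by auto
  interpret conformable_interval J "\<kappa>0 \<alpha>" "\<kappa>1 \<alpha>" t0
  proof
    show "continuous_on J (\<kappa>0 \<alpha>)" "continuous_on J (\<kappa>1 \<alpha>)"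
      using assms(2) unfolding conformable_kernels_def by (auto intro: kernel_cont)
    show "\<kappa>0 \<alpha> t > 0" if "t \<in> J" for t
      using k0_nonneg[OF that] k0_nonzero[OF that] by simp
  qed (use J assms(12) in auto)
  interpret conformable_solution J "\<kappa>0 \<alpha>" "\<kappa>1 \<alpha>" t0 p q x
  proof
    show "continuous_on J p" "continuous_on J q"
      using assms(5,6) J(1) continuous_on_subset by blast+
    show "conf_solution (\<kappa>0 \<alpha>) (\<kappa>1 \<alpha>) p q J x"
      using assms(9) J(1) by (rule conf_solution_subset)
  qed (use assms(7,10) J(1) in auto)
  let ?fo = "first_order_eq (\<kappa>0 \<alpha>) (\<kappa>1 \<alpha>) p t0 J x y"
    and ?rf = "reduction_form (\<kappa>0 \<alpha>) (\<kappa>1 \<alpha>) p t0 J x y"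
    and ?w0 = "p t0 * conf_wronskian (\<kappa>0 \<alpha>) (\<kappa>1 \<alpha>) J x y t0"
  \<comment> \<open>Every claim is reduced to \<open>?fo\<close>: being a solution is
    \<open>?fo c\<close> for some \<open>c\<close>, the integral form is \<open>?fo c2\<close> with
    \<open>c1\<close> forced, independence is \<open>c \<noteq> 0\<close>, and
    \<open>const_eq\<close> identifies the constant.\<close>
  have solution: "conf_solution (\<kappa>0 \<alpha>) (\<kappa>1 \<alpha>) p q J y \<longleftrightarrow> (\<exists>c. ?fo c)"
    using first_order_eq_if_solution solution_if_first_order_eq by blast
  have form: "?rf c1 c2 \<longleftrightarrow> c1 = y t0 / x t0 \<and> ?fo c2" for c1 c2
    using first_order_eq_iff_reduction_form reduction_form_c1 by blast
  have independent: "lin_indep_on J x y \<longleftrightarrow> c \<noteq> 0" and const_eq: "c = ?w0" if "?fo c" for c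
    using that lin_indep_iff first_order_eq_const_eq by blast+
  show ?thesis
    unfolding solution form using independent const_eq by blast
qed

end
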